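(* Let $\mathscr O_2$ be a finite local principal ideal ring of length two with maximal ideal $\mathfrak m=\langle\pi\rangle$ and residue field $k$ of characteristic $p$. Let $A\in \mathrm{M}_n(\mathscr O_2)$ be regular semisimple, and let $F(t)\in\mathscr O_2[t]$ be monic of degree $d$. Suppose there exists $\widetilde B\in\mathrm{M}_n(k)$ such that $\overline F(\widetilde B)=\overline A$ and $\overline{F}'(\widetilde B)\in\mathrm{GL}_n(k)$, where $F'(t)$ is the formal derivative of $F(t)$ in $\mathscr O_2[t]$. Then there exists $B\in\mathrm{GL}_n(\mathscr O_2)$ with $\overline B=\widetilde B$ and $F(B)=A$.
   Context: An overline denotes reduction modulo $\mathfrak m$ of elements, polynomials and matrices; in particular $\overline F'$ is the reduction of $F'$ modulo $\mathfrak m$. A matrix $A\in\mathrm{M}_n(\mathscr O_2)$ is called regular semisimple if its reduction $\overline A\in\mathrm{M}_n(k)$ is regular semisimple, i.e. the characteristic polynomial of $\overline A$ over $k$ is separable. The characteristic $p$ of $k$ is assumed to be an odd prime.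
   Formalization: The claim B in GL_n(O_2) fails for n=1, A=0, F=t, B~=0, where F(B)=A forces B=0; the formal statement gives B in M_n(O_2) with reduction B~ and F(B)=A, and B in GL_n(O_2) whenever B~ is in GL_n(k). *)

theory Defs
  imports
    "HOL-Library.Extended_Nat"
    "HOL-Algebra.Ideal"
    "HOL-Computational_Algebra.Polynomial"
    "Jordan_Normal_Form.Char_Poly"
    "Jordan_Normal_Form.VS_Connect"
begin

definition local_ring :: "('a, 'b) ring_scheme \<Rightarrow> bool" where
  "local_ring R \<longleftrightarrow> cring R \<and> (\<exists>!M. maximalideal M R)"

text \<open>\<open>principal_domain\<close> in HOL-Algebra excludes zero divisors.\<close>

definition principal_ideal_ring :: "('a, 'b) ring_scheme \<Rightarrow> bool" where
  "principal_ideal_ring R \<longleftrightarrow> cring R \<and> (\<forall>I. ideal I R \<longrightarrow> principalideal I R)"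

text \<open>The length of a commutative ring as a module over itself: the supremum of the \<open>l\<close> for which
  there is a strict chain of ideals \<open>I\<^sub>0 \<subset> I\<^sub>1 \<subset> \<dots> \<subset> I\<^sub>l\<close>, such a chain being given by the set of
  its \<open>l + 1\<close> members.\<close>

definition ring_length :: "('a, 'b) ring_scheme \<Rightarrow> enat" where
  "ring_length R =
    (SUP C \<in> {C. finite C \<and> C \<noteq> {} \<and> subset.chain {I. ideal I R} C}. enat (card C - 1))"

text \<open>A residue field of the local ring \<open>'a\<close> with maximal ideal \<open>m\<close> is given, up to isomorphism, by a
  field \<open>'k\<close> and a surjective ring homomorphism \<open>'a \<Rightarrow> 'k\<close> with kernel \<open>m\<close>.  The homomorphism
  is the reduction modulo \<open>m\<close>; on polynomials and matrices it acts by \<^const>\<open>map_poly\<close>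
  and \<^const>\<open>map_mat\<close>.\<close>

definition residue_map :: "'a::comm_ring_1 set \<Rightarrow> ('a \<Rightarrow> 'k::field) \<Rightarrow> bool" where
  "residue_map m red \<longleftrightarrow> comm_ring_hom red \<and> surj red \<and> {x. red x = 0} = m"

text \<open>\<^const>\<open>pderiv\<close> requires a coefficient ring without zero divisors.\<close>

definition formal_deriv :: "'a::comm_ring_1 poly \<Rightarrow> 'a poly" where
  "formal_deriv p = (\<Sum>i = 1..degree p. monom (of_nat i * coeff p i) (i - 1))"

text \<open>\<open>p(A) = \<Sum>\<^sub>i p\<^sub>i A\<^sup>i\<close> for a square matrix \<open>A\<close>, written out entrywise
  because matrices of all sizes share one type, so that there is no matrix \<open>0\<close> for \<^const>\<open>sum\<close>.\<close>

definition poly_mat :: "'a::comm_ring_1 poly \<Rightarrow> 'a mat \<Rightarrow> 'a mat" where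
  "poly_mat p A = mat (dim_row A) (dim_row A)
    (\<lambda>ij. \<Sum>l\<le>degree p. coeff p l * (A ^\<^sub>m l) $$ ij)"

definition separable_poly :: "'k::field poly \<Rightarrow> bool" where
  "separable_poly f \<longleftrightarrow> coprime f (pderiv f)"

definition regular_semisimple :: "('a::comm_ring_1 \<Rightarrow> 'k::field) \<Rightarrow> 'a mat \<Rightarrow> bool" where
  "regular_semisimple red A \<longleftrightarrow> square_mat A \<and> separable_poly (char_poly (map_mat red A))"

end

theory Submission
  imports "HOL-Algebra.Algebraic_Closure_Type" Defs
begin

text \<open>The proof is Hensel lifting along \<open>O\<^sub>2 \<rightarrow> k\<close>, whose kernel is generated by \<open>\<pi>\<close> with \<open>\<pi>\<^sup>2 = 0\<close>.
  Choose any lift \<open>B\<^sub>0\<close> of the given root over \<open>k\<close>. Since \<open>F(B\<^sub>0)\<close> and \<open>A\<close> have the same reduction,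
  \<open>A - F(B\<^sub>0) = \<pi> C\<close> for some matrix \<open>C\<close>, and as \<open>\<pi>\<^sup>2 = 0\<close>,
  \<open>F(B\<^sub>0 + \<pi> U) = F(B\<^sub>0) + \<pi> D(U)\<close> with \<open>D = D\<^bsub>B\<^sub>0\<^esub>\<close>,
  where \<open>D\<^sub>B(U) = \<Sum>\<^sub>l F\<^sub>l \<Sum>\<^bsub>i+j=l-1\<^esub> B\<^sup>i U B\<^sup>j\<close> is the differential of \<open>F\<close> at \<open>B\<close>; it differs from \<open>F'(B) U\<close>
  because \<open>U\<close> need not commute with \<open>B\<close>. It remains to solve \<open>D\<^sub>B(U) = C\<close> over \<open>k\<close>, for which the
  linear map \<open>D\<^sub>B\<close> has to be surjective. The space of matrices over the finite field \<open>k\<close> is finite,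
  so injectivity suffices.

  Let \<open>D\<^sub>B(U) = 0\<close>. The sum telescopes in the commutator with \<open>B\<close> (\<open>poly_mat_deriv_commutator\<close>):
  \<open>B D\<^sub>B(U) - D\<^sub>B(U) B = F(B) U - U F(B)\<close>.
  Thus \<open>U\<close> commutes with \<open>F(B)\<close>, and so does \<open>B\<close>. Here the regular semisimplicity of \<open>F(B)\<close> enters:
  its centralizer is commutative (\<open>centralizer_commutative\<close>), since over the algebraic closure it
  consists of the matrices that are diagonal in a basis of eigenvectors. Hence \<open>B\<close> and \<open>U\<close> commute,
  \<open>D\<^sub>B(U) = F'(B) U\<close>, and \<open>U = 0\<close> because \<open>F'(B)\<close> is invertible.

  That \<open>\<pi>\<^sup>2 = 0\<close> follows from the length: otherwise \<open>0 \<subset> (\<pi>\<^sup>2) \<subset> (\<pi>) \<subset> O\<^sub>2\<close> would be a strict chain of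
  ideals of length three. The lift is invertible when its reduction is, because an element with
  nonzero residue is a unit. In general it is not: for \<open>F = t\<close>, \<open>n = 1\<close> and \<open>A = 0\<close> the only root is \<open>0\<close>.\<close>

section \<open>Centralizers of matrices with separable characteristic polynomial\<close>

text \<open>A Bezout identity, unlike coprimality itself, is visibly preserved by ring homomorphisms; this is
  how separability passes to the algebraic closure.\<close>

lemma coprime_imp_bezout:
  fixes a b :: "'a::euclidean_ring"
  assumes "coprime a b"
  obtains u w where "u * a + w * b = 1"
proof -
  have "\<exists>u w. u * a + w * b = 1"
    using assms
  proof (induction "euclidean_size b" arbitrary: a b rule: less_induct)
    case (less b a)
    show ?case
    proof (cases "b = 0")
      case True
      then have "a dvd 1"
        using less.prems by simp
      then show ?thesis
        using True by (metis add.right_neutral dvd_def mult.commute mult_zero_right)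
    next
      case False
      have "coprime b (a mod b)"
        using less.prems False by (simp add: coprime_commute)
      with less.hyps[OF mod_size_less[OF False]] obtain u w where "u * b + w * (a mod b) = 1"
        by blast
      then have "w * a + (u - w * (a div b)) * b = 1"
        by (simp add: algebra_simps minus_div_mult_eq_mod [symmetric])
      then show ?thesis
        by blast
    qed
  qed
  with that show thesis
    by blast
qed

lemma separable_poly_distinct_roots:
  fixes f :: "'k::alg_closed_field poly"
  assumes "separable_poly f" and "f \<noteq> 0"
  obtains xs where "distinct xs" "length xs = degree f" "\<And>x. x \<in> set xs \<Longrightarrow> poly f x = 0"
proof -
  obtain M where M: "size M = degree f" "f = smult (lead_coeff f) (\<Prod>x\<in>#M. [:-x, 1:])"
    using alg_closed_imp_factorization[OF assms(2)] by blast
  obtain xs where xs: "M = mset xs"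
    by (metis ex_mset)
  have f: "f = smult (lead_coeff f) (\<Prod>x\<leftarrow>xs. [:-x, 1:])"
    using M(2) by (simp add: xs prod_mset_prod_list flip: mset_map)
  have root: "poly f x = 0" if "x \<in> set xs" for x
    by (subst f) (use that in \<open>auto simp: poly_prod_list prod_list_zero_iff\<close>)
  have "distinct xs"
  proof (rule ccontr)
    assume "\<not> distinct xs"
    then obtain as bs cs y where "xs = as @ [y] @ bs @ [y] @ cs"
      using not_distinct_decomp by blast
    then have "f = [:-y, 1:] * ([:-y, 1:] * smult (lead_coeff f) (\<Prod>x\<leftarrow>as @ bs @ cs. [:-x, 1:]))"
      by (subst f) (simp add: algebra_simps)
    then obtain q where q: "f = [:-y, 1:] * ([:-y, 1:] * q)"
      by blast
    have "[:-y, 1:] dvd f"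
      using dvd_triv_left[of "[:-y, 1:]" "[:-y, 1:] * q"] by (simp only: flip: q)
    moreover have "[:-y, 1:] dvd pderiv f"
    proof -
      have "pderiv f = [:-y, 1:] * pderiv ([:-y, 1:] * q) + [:-y, 1:] * q * pderiv [:-y, 1:]"
        by (subst q) (rule pderiv_mult)
      then show ?thesis
        by (metis dvd_add dvd_mult2 dvd_triv_left)
    qed
    ultimately have "is_unit [:-y, 1:]"
      using assms(1) unfolding separable_poly_def by (rule coprime_common_divisor[rotated])
    then show False
      by (simp add: is_unit_iff_degree)
  qed
  with that root M(1) xs show thesis
    by simp
qed

text \<open>Eigenvectors \<open>v\<^sub>i\<close> for distinct eigenvalues \<open>a\<^sub>i\<close> are linearly independent: from a nontrivial
  relation \<open>\<Sum>\<^sub>i x\<^sub>i v\<^sub>i = 0\<close> and an index \<open>i\<close> with \<open>x\<^sub>i \<noteq> 0\<close>, applying \<open>A - a\<^sub>i\<close> produces the shorter relation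
  with coefficients \<open>(a\<^sub>j - a\<^sub>i) x\<^sub>j\<close>. Minimality of the support leaves \<open>x\<^sub>i v\<^sub>i = 0\<close>, which is absurd.\<close>

lemma eigenvector_matrix:
  fixes A P :: "'k::field mat"
  assumes A: "A \<in> carrier_mat n n" and P: "P \<in> carrier_mat n n"
    and eig: "\<And>j. j < n \<Longrightarrow> A *\<^sub>v col P j = a j \<cdot>\<^sub>v col P j"
    and nz: "\<And>j. j < n \<Longrightarrow> col P j \<noteq> 0\<^sub>v n"
    and inj: "inj_on a {0..<n}"
  shows "A * P = P * mat_diag n a" and "det P \<noteq> 0"
proof -
  define D where "D = mat_diag n a"
  have D: "D \<in> carrier_mat n n" by (simp add: D_def)
  have Dv: "(D *\<^sub>v x) $ i = a i * x $ i" if "x \<in> carrier_vec n" "i < n" for x i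
    using that by (simp add: D_def mat_diag_def scalar_prod_def if_distrib[of "\<lambda>t. t * _"] cong: if_cong)
  have AP: "A * P = P * D"
  proof (rule eq_matI)
    fix i j assume "i < dim_row (P * D)" "j < dim_col (P * D)"
    then have ij: "i < n" "j < n" using P D by auto
    have "(A * P) $$ (i, j) = (A *\<^sub>v col P j) $ i"
      using A P ij by simp
    also have "\<dots> = P $$ (i, j) * a j"
      using eig[of j] P ij by simp
    also have "\<dots> = (P * D) $$ (i, j)"
      using ij by (simp add: D_def mat_diag_mult_right[OF P])
    finally show "(A * P) $$ (i, j) = (P * D) $$ (i, j)" .
  qed (use A P D in auto)
  have ker: "x = 0\<^sub>v n" if "x \<in> carrier_vec n" "P *\<^sub>v x = 0\<^sub>v n" for x
    using that
  proof (induction "card {i. i < n \<and> x $ i \<noteq> 0}" arbitrary: x rule: less_induct)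
    case (less x)
    show ?case
    proof (rule ccontr)
      assume "x \<noteq> 0\<^sub>v n"
      then obtain i where i: "i < n" "x $ i \<noteq> 0"
        using less.prems(1) by (metis carrier_vecD eq_vecI index_zero_vec)
      \<comment> \<open>\<open>P y = (A - a\<^sub>i) P x\<close>, and the coefficient at \<open>i\<close> disappears.\<close>
      define y where "y = D *\<^sub>v x - a i \<cdot>\<^sub>v x"
      have y: "y \<in> carrier_vec n"
        using less.prems(1) D by (auto simp: y_def)
      have yj: "y $ j = (a j - a i) * x $ j" if "j < n" for j
        using that less.prems(1) D Dv[of x j] by (simp add: y_def algebra_simps)
      have "P *\<^sub>v y = P *\<^sub>v (D *\<^sub>v x) - P *\<^sub>v (a i \<cdot>\<^sub>v x)"
        unfolding y_def using P D less.prems(1) by (intro mult_minus_distrib_mat_vec) auto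
      also have "P *\<^sub>v (D *\<^sub>v x) = A *\<^sub>v (P *\<^sub>v x)"
        using AP A P D less.prems(1) by (metis assoc_mult_mat_vec)
      also have "P *\<^sub>v (a i \<cdot>\<^sub>v x) = a i \<cdot>\<^sub>v (P *\<^sub>v x)"
        using P less.prems(1) by (simp add: mult_mat_vec)
      finally have Py: "P *\<^sub>v y = 0\<^sub>v n"
        using less.prems A by auto
      have "{j. j < n \<and> y $ j \<noteq> 0} \<subseteq> {j. j < n \<and> x $ j \<noteq> 0}"
        by (auto simp: yj)
      moreover have "i \<in> {j. j < n \<and> x $ j \<noteq> 0}" "i \<notin> {j. j < n \<and> y $ j \<noteq> 0}"
        using i by (auto simp: yj)
      ultimately have "{j. j < n \<and> y $ j \<noteq> 0} \<subset> {j. j < n \<and> x $ j \<noteq> 0}"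
        by blast
      then have "card {j. j < n \<and> y $ j \<noteq> 0} < card {j. j < n \<and> x $ j \<noteq> 0}"
        by (intro psubset_card_mono) auto
      from less.hyps[OF this y Py] have y0: "y = 0\<^sub>v n" .
      have xj: "x $ j = 0" if j: "j < n" "j \<noteq> i" for j
      proof -
        have "a j \<noteq> a i"
          using inj i(1) j by (auto simp: inj_on_def)
        with yj[OF j(1)] y0 j(1) show ?thesis
          by simp
      qed
      have "P *\<^sub>v x = x $ i \<cdot>\<^sub>v col P i"
      proof (rule eq_vecI)
        fix r assume "r < dim_vec (x $ i \<cdot>\<^sub>v col P i)"
        then have r: "r < n" using P by simp
        have "(P *\<^sub>v x) $ r = (\<Sum>j = 0..<n. P $$ (r, j) * x $ j)"
          using P less.prems(1) r by (simp add: scalar_prod_def)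
        also have "\<dots> = (\<Sum>j = 0..<n. if j = i then P $$ (r, i) * x $ i else 0)"
          by (intro sum.cong) (auto simp: xj)
        also have "\<dots> = (x $ i \<cdot>\<^sub>v col P i) $ r"
          using i P r by simp
        finally show "(P *\<^sub>v x) $ r = (x $ i \<cdot>\<^sub>v col P i) $ r" .
      qed (use P in auto)
      then have eq: "x $ i \<cdot>\<^sub>v col P i = 0\<^sub>v n"
        using less.prems(2) by simp
      have "col P i = 0\<^sub>v n"
      proof (rule eq_vecI)
        fix r assume r: "r < dim_vec (0\<^sub>v n)"
        then have "(x $ i \<cdot>\<^sub>v col P i) $ r = 0"
          by (simp add: eq)
        with r P i show "col P i $ r = 0\<^sub>v n $ r"
          by simp
      qed (use P in auto)
      with nz[OF i(1)] show False by simp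
    qed
  qed
  then show "det P \<noteq> 0"
    using det_0_iff_vec_prod_zero_field[OF P] by blast
  show "A * P = P * mat_diag n a"
    using AP by (simp add: D_def)
qed

lemma commutes_with_diag_imp_diag:
  fixes U :: "'k::idom mat"
  assumes U: "U \<in> carrier_mat n n" and inj: "inj_on a {0..<n}"
    and comm: "mat_diag n a * U = U * mat_diag n a"
  shows "U = mat_diag n (\<lambda>i. U $$ (i, i))"
proof (rule eq_matI)
  fix i j assume "i < dim_row (mat_diag n (\<lambda>i. U $$ (i, i)))" "j < dim_col (mat_diag n (\<lambda>i. U $$ (i, i)))"
  then have ij: "i < n" "j < n"
    by (simp_all add: carrier_matD[OF mat_diag_dim])
  have "a i * U $$ (i, j) = U $$ (i, j) * a j"
    using arg_cong[OF comm, of "\<lambda>M. M $$ (i, j)"] ij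
    by (simp add: mat_diag_mult_left[OF U] mat_diag_mult_right[OF U])
  then have "a i = a j \<or> U $$ (i, j) = 0"
    by (auto simp: mult.commute)
  then show "U $$ (i, j) = mat_diag n (\<lambda>i. U $$ (i, i)) $$ (i, j)"
    using inj ij by (auto simp: mat_diag_def inj_on_def)
qed (use U in \<open>simp_all add: mat_diag_def\<close>)

text \<open>In a basis of eigenvectors \<open>A\<close> is diagonal with distinct entries, so that everything commuting
  with \<open>A\<close> is diagonal as well, and diagonal matrices commute with each other.\<close>

lemma centralizer_commutative_alg_closed:
  fixes A U V :: "'k::alg_closed_field mat"
  assumes A: "A \<in> carrier_mat n n" and U: "U \<in> carrier_mat n n" and V: "V \<in> carrier_mat n n"
    and sep: "separable_poly (char_poly A)"
    and AU: "A * U = U * A" and AV: "A * V = V * A"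
  shows "U * V = V * U"
proof -
  have "char_poly A \<noteq> 0" "degree (char_poly A) = n"
    using degree_monic_char_poly[OF A] by auto
  with separable_poly_distinct_roots[OF sep] obtain xs where
    xs: "distinct xs" "length xs = n" "\<And>x. x \<in> set xs \<Longrightarrow> poly (char_poly A) x = 0"
    by metis
  have "\<exists>v. eigenvector A v (xs ! j)" if "j < n" for j
    using eigenvalue_root_char_poly[OF A] xs(2,3) that unfolding eigenvalue_def by auto
  then obtain v where v: "\<And>j. j < n \<Longrightarrow> eigenvector A (v j) (xs ! j)"
    by metis
  define P where "P = mat n n (\<lambda>(i,j). v j $ i)"
  have P: "P \<in> carrier_mat n n"
    by (simp add: P_def)
  have col: "col P j = v j" if "j < n" for j
    using v[OF that] A that unfolding eigenvector_def P_def by (intro eq_vecI) auto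
  have eig: "A *\<^sub>v col P j = xs ! j \<cdot>\<^sub>v col P j" "col P j \<noteq> 0\<^sub>v n" if "j < n" for j
    using v[OF that] A by (auto simp: col[OF that] eigenvector_def)
  have inj: "inj_on ((!) xs) {0..<n}"
    using xs(1,2) by (auto simp: inj_on_def nth_eq_iff_index_eq)
  note AP = eigenvector_matrix(1)[OF A P eig inj]
    and det = eigenvector_matrix(2)[OF A P eig inj]
  from det obtain Q where Q: "Q \<in> carrier_mat n n" "P * Q = 1\<^sub>m n" "Q * P = 1\<^sub>m n"
    using det_non_zero_imp_unit[OF P, of "()"] by (auto simp: Units_def ring_mat_simps)
  have conj_mult: "(Q * W * P) * (Q * Z * P) = Q * (W * Z) * P"
    if "W \<in> carrier_mat n n" "Z \<in> carrier_mat n n" for W Z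
  proof -
    have "(Q * W * P) * (Q * Z * P) = Q * (W * ((P * Q) * (Z * P)))"
      using P Q(1) that by (simp add: assoc_mult_mat[of _ n n _ n _ n])
    also have "\<dots> = Q * (W * Z) * P"
      unfolding Q(2) using P Q(1) that by (simp add: assoc_mult_mat[of _ n n _ n _ n])
    finally show ?thesis .
  qed
  have QAP: "Q * A * P = mat_diag n ((!) xs)"
  proof -
    have "Q * A * P = (Q * P) * mat_diag n ((!) xs)"
      using A P Q(1) by (simp add: assoc_mult_mat[of _ n n _ n _ n] AP)
    then show ?thesis
      by (simp add: Q(3) left_mult_one_mat[OF mat_diag_dim])
  qed
  have diag: "Q * W * P = mat_diag n (\<lambda>i. (Q * W * P) $$ (i, i))"
    if W: "W \<in> carrier_mat n n" "A * W = W * A" for W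
    using W P Q(1) conj_mult[OF A W(1)] conj_mult[OF W(1) A]
    by (intro commutes_with_diag_imp_diag[OF _ inj]) (simp_all flip: QAP)
  have "Q * (U * V) * P = Q * (V * U) * P"
    unfolding conj_mult[OF U V, symmetric] conj_mult[OF V U, symmetric]
    by (subst (1 2) diag[OF U AU], subst (1 2) diag[OF V AV]) (simp add: mult.commute)
  moreover have "P * (Q * W * P) * Q = W" if W: "W \<in> carrier_mat n n" for W
  proof -
    have "P * (Q * W * P) * Q = (P * Q) * W * (P * Q)"
      using P Q(1) W by (simp add: assoc_mult_mat[of _ n n _ n _ n])
    then show ?thesis
      using W by (simp add: Q(2))
  qed
  ultimately show ?thesis
    using U V by (metis mult_carrier_mat)
qed

text \<open>The eigenvalues need not lie in the field. However, an identity of matrices may be checked over the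
  algebraic closure.\<close>

lemma centralizer_commutative:
  fixes A U V :: "'k::field mat"
  assumes A: "A \<in> carrier_mat n n" and U: "U \<in> carrier_mat n n" and V: "V \<in> carrier_mat n n"
    and sep: "separable_poly (char_poly A)"
    and AU: "A * U = U * A" and AV: "A * V = V * A"
  shows "U * V = V * U"
proof -
  interpret ac: field_hom "to_ac :: 'k \<Rightarrow> 'k alg_closure"
    by unfold_locales auto
  interpret acp: map_poly_comm_ring_hom "to_ac :: 'k \<Rightarrow> 'k alg_closure" ..
  let ?f = "char_poly A"
  let ?h = "map_mat (to_ac :: 'k \<Rightarrow> 'k alg_closure)"
  obtain u w where bezout: "u * ?f + w * pderiv ?f = 1"
    using sep unfolding separable_poly_def by (rule coprime_imp_bezout)
  have "map_poly to_ac u * map_poly to_ac ?f + map_poly to_ac w * pderiv (map_poly to_ac ?f)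
      = (1 :: 'k alg_closure poly)"
    using arg_cong[OF bezout, of "map_poly (to_ac :: 'k \<Rightarrow> 'k alg_closure)"]
    by (simp add: acp.hom_add acp.hom_mult ac.map_poly_pderiv)
  then have "separable_poly (map_poly to_ac ?f :: 'k alg_closure poly)"
    unfolding separable_poly_def by (intro coprimeI) (metis dvd_add dvd_mult)
  then have sep': "separable_poly (char_poly (?h A))"
    by (simp add: ac.char_poly_hom[OF A])
  have comm: "?h A * ?h U = ?h U * ?h A" "?h A * ?h V = ?h V * ?h A"
    using arg_cong[OF AU, of ?h] arg_cong[OF AV, of ?h]
    unfolding ac.mat_hom_mult[OF A U] ac.mat_hom_mult[OF A V]
      ac.mat_hom_mult[OF U A] ac.mat_hom_mult[OF V A] .
  have "?h A \<in> carrier_mat n n" "?h U \<in> carrier_mat n n" "?h V \<in> carrier_mat n n"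
    using A U V by simp_all
  from centralizer_commutative_alg_closed[OF this sep' comm]
  have "?h U * ?h V = ?h V * ?h U" .
  then have "?h (U * V) = ?h (V * U)"
    unfolding ac.mat_hom_mult[OF U V] ac.mat_hom_mult[OF V U] .
  then show ?thesis
    by (rule ac.mat_hom_inj)
qed

section \<open>Polynomials at a matrix and their differential\<close>

text \<open>The size \<open>n\<close> is a parameter because matrices of all sizes share one type, which therefore has no
  additive monoid structure for \<^const>\<open>sum\<close>.\<close>

definition mat_lincomb :: "nat \<Rightarrow> (nat \<Rightarrow> 'a::comm_ring_1) \<Rightarrow> (nat \<Rightarrow> 'a mat) \<Rightarrow> nat \<Rightarrow> 'a mat" where
  "mat_lincomb n c M N = mat n n (\<lambda>ij. \<Sum>l\<le>N. c l * M l $$ ij)"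

lemma mat_lincomb_carrier [simp]: "mat_lincomb n c M N \<in> carrier_mat n n"
  by (simp add: mat_lincomb_def)

lemma mat_lincomb_dim [simp]: "dim_row (mat_lincomb n c M N) = n" "dim_col (mat_lincomb n c M N) = n"
  by (simp_all add: mat_lincomb_def)

lemma mult_mat_lincomb:
  assumes "U \<in> carrier_mat n n" and "\<And>l. M l \<in> carrier_mat n n"
  shows "U * mat_lincomb n c M N = mat_lincomb n c (\<lambda>l. U * M l) N"
proof (rule eq_matI)
  fix i j assume "i < dim_row (mat_lincomb n c (\<lambda>l. U * M l) N)" "j < dim_col (mat_lincomb n c (\<lambda>l. U * M l) N)"
  then have ij: "i < n" "j < n" by simp_all
  have "(U * mat_lincomb n c M N) $$ (i, j) = (\<Sum>k = 0..<n. \<Sum>l\<le>N. c l * (U $$ (i, k) * M l $$ (k, j)))"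
    using assms(1) ij by (simp add: mat_lincomb_def scalar_prod_def sum_distrib_left mult.left_commute)
  also have "\<dots> = (\<Sum>l\<le>N. c l * (\<Sum>k = 0..<n. U $$ (i, k) * M l $$ (k, j)))"
    by (subst sum.swap) (simp add: sum_distrib_left)
  also have "\<dots> = mat_lincomb n c (\<lambda>l. U * M l) N $$ (i, j)"
    using assms(1) carrier_matD[OF assms(2)] ij by (simp add: mat_lincomb_def scalar_prod_def)
  finally show "(U * mat_lincomb n c M N) $$ (i, j) = mat_lincomb n c (\<lambda>l. U * M l) N $$ (i, j)" .
qed (use assms in auto)

lemma mat_lincomb_mult:
  assumes "U \<in> carrier_mat n n" and "\<And>l. M l \<in> carrier_mat n n"
  shows "mat_lincomb n c M N * U = mat_lincomb n c (\<lambda>l. M l * U) N"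
proof (rule eq_matI)
  fix i j assume "i < dim_row (mat_lincomb n c (\<lambda>l. M l * U) N)" "j < dim_col (mat_lincomb n c (\<lambda>l. M l * U) N)"
  then have ij: "i < n" "j < n" by simp_all
  have "(mat_lincomb n c M N * U) $$ (i, j) = (\<Sum>k = 0..<n. \<Sum>l\<le>N. c l * (M l $$ (i, k) * U $$ (k, j)))"
    using assms(1) ij by (simp add: mat_lincomb_def scalar_prod_def sum_distrib_right mult.assoc)
  also have "\<dots> = (\<Sum>l\<le>N. c l * (\<Sum>k = 0..<n. M l $$ (i, k) * U $$ (k, j)))"
    by (subst sum.swap) (simp add: sum_distrib_left)
  also have "\<dots> = mat_lincomb n c (\<lambda>l. M l * U) N $$ (i, j)"
    using assms(1) carrier_matD[OF assms(2)] ij by (simp add: mat_lincomb_def scalar_prod_def)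
  finally show "(mat_lincomb n c M N * U) $$ (i, j) = mat_lincomb n c (\<lambda>l. M l * U) N $$ (i, j)" .
qed (use assms in auto)

lemma mat_lincomb_minus:
  assumes "\<And>l. M l \<in> carrier_mat n n" and "\<And>l. M' l \<in> carrier_mat n n"
  shows "mat_lincomb n c (\<lambda>l. M l - M' l) N = mat_lincomb n c M N - mat_lincomb n c M' N"
  using carrier_matD[OF assms(1)] carrier_matD[OF assms(2)]
  by (intro eq_matI) (simp_all add: mat_lincomb_def algebra_simps sum_subtractf)

lemma mat_lincomb_add_smult:
  assumes "\<And>l. M l \<in> carrier_mat n n" and "\<And>l. M' l \<in> carrier_mat n n"
  shows "mat_lincomb n c (\<lambda>l. M l + r \<cdot>\<^sub>m M' l) N = mat_lincomb n c M N + r \<cdot>\<^sub>m mat_lincomb n c M' N"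
  using carrier_matD[OF assms(1)] carrier_matD[OF assms(2)]
  by (intro eq_matI)
     (simp_all add: mat_lincomb_def distrib_left sum.distrib sum_distrib_left mult.left_commute)

lemma (in comm_ring_hom) map_mat_lincomb:
  assumes "\<And>l. M l \<in> carrier_mat n n"
  shows "map_mat hom (mat_lincomb n c M N) = mat_lincomb n (hom \<circ> c) (\<lambda>l. map_mat hom (M l)) N"
  using carrier_matD[OF assms]
  by (intro eq_matI) (simp_all add: mat_lincomb_def hom_sum hom_mult)

text \<open>The freedom in the bound \<open>N\<close> lets \<open>f\<close> and its derivative, whose degree may drop by more than one in
  positive characteristic, be summed over the same range.\<close>

lemma poly_mat_eq_lincomb:
  assumes "B \<in> carrier_mat n n" and "degree f \<le> N"
  shows "poly_mat f B = mat_lincomb n (coeff f) (\<lambda>l. B ^\<^sub>m l) N"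
proof -
  have "(\<Sum>l\<le>degree f. coeff f l * t l) = (\<Sum>l\<le>N. coeff f l * t l)" for t :: "nat \<Rightarrow> 'a"
    using assms(2) by (intro sum.mono_neutral_left) (auto simp: coeff_eq_0)
  then show ?thesis
    using assms(1) by (simp add: poly_mat_def mat_lincomb_def)
qed

lemma poly_mat_carrier: "B \<in> carrier_mat n n \<Longrightarrow> poly_mat f B \<in> carrier_mat n n"
  by (simp add: poly_mat_def)

lemma (in comm_ring_hom) map_poly_mat:
  assumes "B \<in> carrier_mat n n"
  shows "map_mat hom (poly_mat f B) = poly_mat (map_poly hom f) (map_mat hom B)"
proof -
  have coeff: "coeff (map_poly hom f) = (\<lambda>l. hom (coeff f l))"
    by (simp add: coeff_map_poly fun_eq_iff)
  have "map_mat hom (poly_mat f B)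
      = mat_lincomb n (hom \<circ> coeff f) (\<lambda>l. map_mat hom (B ^\<^sub>m l)) (degree f)"
    using assms by (simp add: poly_mat_eq_lincomb[of _ n _ "degree f"] map_mat_lincomb)
  also have "\<dots> = poly_mat (map_poly hom f) (map_mat hom B)"
    using assms
    by (simp add: poly_mat_eq_lincomb[of _ n _ "degree f"] degree_map_poly_le mat_hom_pow
        coeff comp_def)
  finally show ?thesis .
qed

lemma pow_mat_commutes:
  assumes "B \<in> carrier_mat n n"
  shows "B * B ^\<^sub>m l = B ^\<^sub>m l * B"
  using assms by (induction l) (simp_all add: assoc_mult_mat[of _ n n _ n _ n, symmetric])

lemma poly_mat_commutes:
  assumes B: "B \<in> carrier_mat n n"
  shows "B * poly_mat f B = poly_mat f B * B"
  using B pow_mat_commutes[OF B]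
  by (simp add: poly_mat_eq_lincomb[of _ n _ "degree f"] mult_mat_lincomb mat_lincomb_mult)

text \<open>The differential of \<open>B \<mapsto> B\<^sup>l\<close> in the direction \<open>U\<close>, that is \<open>\<Sum>\<^bsub>i+j=l-1\<^esub> B\<^sup>i U B\<^sup>j\<close>. The recursion is the
  product rule for \<open>B\<^sup>l B\<close>.\<close>

primrec pow_deriv :: "'a::comm_ring_1 mat \<Rightarrow> 'a mat \<Rightarrow> nat \<Rightarrow> 'a mat" where
  "pow_deriv B U 0 = 0\<^sub>m (dim_row B) (dim_row B)"
| "pow_deriv B U (Suc l) = pow_deriv B U l * B + B ^\<^sub>m l * U"

lemma pow_deriv_dim [simp]:
  "dim_row (pow_deriv B U l) = dim_row B"
  "dim_col U = dim_row B \<Longrightarrow> dim_col (pow_deriv B U l) = dim_row B"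
  by (cases l; simp)+

lemma pow_deriv_carrier [simp]:
  assumes "B \<in> carrier_mat n n" and "U \<in> carrier_mat n n"
  shows "pow_deriv B U l \<in> carrier_mat n n"
  using assms by (intro carrier_matI) auto

definition poly_mat_deriv :: "'a::comm_ring_1 poly \<Rightarrow> 'a mat \<Rightarrow> 'a mat \<Rightarrow> 'a mat" where
  "poly_mat_deriv f B U = mat_lincomb (dim_row B) (coeff f) (pow_deriv B U) (degree f)"

lemma poly_mat_deriv_carrier:
  "B \<in> carrier_mat n n \<Longrightarrow> poly_mat_deriv f B U \<in> carrier_mat n n"
  by (simp add: poly_mat_deriv_def)

lemma pow_deriv_minus:
  assumes "B \<in> carrier_mat n n" and "U \<in> carrier_mat n n" and "V \<in> carrier_mat n n"
  shows "pow_deriv B (U - V) l = pow_deriv B U l - pow_deriv B V l"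
proof (induction l)
  case (Suc l)
  let ?P = "pow_deriv B U l * B" and ?Q = "pow_deriv B V l * B" and ?R = "B ^\<^sub>m l * U" and ?S = "B ^\<^sub>m l * V"
  have "pow_deriv B (U - V) (Suc l) = (?P - ?Q) + (?R - ?S)"
    using assms by (simp add: Suc minus_mult_distrib_mat[of _ n n _ _ n] mult_minus_distrib_mat[of _ n n _ n])
  also have "\<dots> = (?P + ?R) - (?Q + ?S)"
    using assms by (intro eq_matI) auto
  finally show ?case by simp
qed (use assms in auto)

lemma poly_mat_deriv_minus:
  assumes "B \<in> carrier_mat n n" and "U \<in> carrier_mat n n" and "V \<in> carrier_mat n n"
  shows "poly_mat_deriv f B (U - V) = poly_mat_deriv f B U - poly_mat_deriv f B V"
proof -
  have "pow_deriv B (U - V) = (\<lambda>l. pow_deriv B U l - pow_deriv B V l)"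
    using pow_deriv_minus[OF assms] by blast
  then show ?thesis
    using assms by (simp add: poly_mat_deriv_def mat_lincomb_minus)
qed

lemma pow_deriv_expansion:
  assumes B: "B \<in> carrier_mat n n" and U: "U \<in> carrier_mat n n" and "r * r = 0"
  shows "(B + r \<cdot>\<^sub>m U) ^\<^sub>m l = B ^\<^sub>m l + r \<cdot>\<^sub>m pow_deriv B U l"
proof (induction l)
  case (Suc l)
  let ?P = "B ^\<^sub>m l" and ?D = "pow_deriv B U l"
  have P: "?P \<in> carrier_mat n n" and D: "?D \<in> carrier_mat n n"
    using B U by simp_all
  have "(?P + r \<cdot>\<^sub>m ?D) * (B + r \<cdot>\<^sub>m U)
      = (?P * B + r \<cdot>\<^sub>m (?D * B)) + r \<cdot>\<^sub>m (?P * U + r \<cdot>\<^sub>m (?D * U))"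
    using B U P D
    by (simp add: mult_add_distrib_mat[of _ n n _ n] add_mult_distrib_mat[of _ n n _ _ n]
        mult_smult_distrib[of _ n n _ n] mult_smult_assoc_mat[of _ n n _ n])
  also have "\<dots> = ?P * B + r \<cdot>\<^sub>m (?D * B + ?P * U)"
    using B U P D assms(3)
    by (intro eq_matI) (auto simp: distrib_left mult.assoc[symmetric] simp del: index_mult_mat(1))
  finally show ?case
    by (simp add: Suc)
qed (use B U in auto)

lemma poly_mat_expansion:
  assumes B: "B \<in> carrier_mat n n" and U: "U \<in> carrier_mat n n" and "r * r = 0"
  shows "poly_mat f (B + r \<cdot>\<^sub>m U) = poly_mat f B + r \<cdot>\<^sub>m poly_mat_deriv f B U"
  using B U pow_deriv_expansion[OF assms]
  by (simp add: poly_mat_eq_lincomb[of _ n _ "degree f"] poly_mat_deriv_def mat_lincomb_add_smult)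

text \<open>A noncommutative form of \<open>(x - y) \<Sum>\<^bsub>i+j=l-1\<^esub> x\<^sup>i y\<^sup>j = x\<^sup>l - y\<^sup>l\<close>, where \<open>x\<close> and \<open>y\<close> are the multiplications
  by \<open>B\<close> from the left and from the right.\<close>

lemma pow_deriv_commutator:
  assumes B: "B \<in> carrier_mat n n" and U: "U \<in> carrier_mat n n"
  shows "B * pow_deriv B U l - pow_deriv B U l * B = B ^\<^sub>m l * U - U * B ^\<^sub>m l"
proof (induction l)
  case (Suc l)
  let ?P = "B ^\<^sub>m l" and ?D = "pow_deriv B U l"
  have P: "?P \<in> carrier_mat n n" and D: "?D \<in> carrier_mat n n"
    using B U by simp_all
  note BP = pow_mat_commutes[OF B, of l]
  have "B * pow_deriv B U (Suc l) - pow_deriv B U (Suc l) * B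
      = (B * ?D * B + B * ?P * U) - (?D * B * B + ?P * U * B)"
    using B U P D
    by (simp add: mult_add_distrib_mat[of _ n n _ n] add_mult_distrib_mat[of _ n n _ _ n]
        assoc_mult_mat[of _ n n _ n _ n] mult_carrier_mat[of _ n n _ n])
  also have "\<dots> = (B * ?D - ?D * B) * B + (?P * B * U - ?P * U * B)"
    unfolding BP minus_mult_distrib_mat[OF mult_carrier_mat[OF B D] mult_carrier_mat[OF D B] B]
    using B U P D by (intro eq_matI) (auto simp del: index_mult_mat(1))
  also have "\<dots> = (?P * U * B - U * ?P * B) + (?P * B * U - ?P * U * B)"
    unfolding Suc minus_mult_distrib_mat[OF mult_carrier_mat[OF P U] mult_carrier_mat[OF U P] B] ..
  also have "\<dots> = ?P * B * U - U * ?P * B"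
    using B U P by (intro eq_matI) (auto simp del: index_mult_mat(1))
  finally show ?case
    using B U P by (simp add: assoc_mult_mat[of _ n n _ n _ n])
qed (use B U in auto)

lemma poly_mat_deriv_commutator:
  assumes B: "B \<in> carrier_mat n n" and U: "U \<in> carrier_mat n n"
  shows "B * poly_mat_deriv f B U - poly_mat_deriv f B U * B = poly_mat f B * U - U * poly_mat f B"
proof -
  let ?L = "\<lambda>M. mat_lincomb n (coeff f) M (degree f)"
  have "B * poly_mat_deriv f B U - poly_mat_deriv f B U * B
      = ?L (\<lambda>l. B * pow_deriv B U l - pow_deriv B U l * B)"
    using B U by (simp add: poly_mat_deriv_def mult_mat_lincomb mat_lincomb_mult mat_lincomb_minus
        mult_carrier_mat[of _ n n _ n])
  also have "\<dots> = ?L (\<lambda>l. B ^\<^sub>m l * U - U * B ^\<^sub>m l)"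
    by (simp only: pow_deriv_commutator[OF assms])
  also have "\<dots> = poly_mat f B * U - U * poly_mat f B"
    using B U by (simp add: poly_mat_eq_lincomb[of _ n _ "degree f"] mult_mat_lincomb
        mat_lincomb_mult mat_lincomb_minus mult_carrier_mat[of _ n n _ n])
  finally show ?thesis .
qed

lemma coeff_formal_deriv: "coeff (formal_deriv f) i = of_nat (Suc i) * coeff f (Suc i)"
proof -
  have "coeff (formal_deriv f) i = (\<Sum>j = 1..degree f. if j = Suc i then of_nat j * coeff f j else 0)"
    unfolding formal_deriv_def coeff_sum by (intro sum.cong) auto
  also have "\<dots> = of_nat (Suc i) * coeff f (Suc i)"
    by (auto simp: coeff_eq_0)
  finally show ?thesis .
qed

lemma degree_formal_deriv: "degree (formal_deriv f) \<le> degree f - 1"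
  by (rule degree_le) (auto simp: coeff_formal_deriv coeff_eq_0)

lemma (in comm_ring_hom) map_formal_deriv: "map_poly hom (formal_deriv f) = formal_deriv (map_poly hom f)"
  by (rule poly_eqI) (simp add: coeff_map_poly coeff_formal_deriv hom_mult hom_of_nat hom_add)

lemma pow_deriv_commuting:
  assumes B: "B \<in> carrier_mat n n" and U: "U \<in> carrier_mat n n" and comm: "B * U = U * B"
  shows "pow_deriv B U (Suc l) = of_nat (Suc l) \<cdot>\<^sub>m (B ^\<^sub>m l * U)"
proof (induction l)
  case (Suc l)
  have "B ^\<^sub>m l * U * B = B ^\<^sub>m Suc l * U"
    using B U comm by (simp add: assoc_mult_mat[of _ n n _ n _ n])
  then have "pow_deriv B U (Suc (Suc l))
      = of_nat (Suc l) \<cdot>\<^sub>m (B ^\<^sub>m Suc l * U) + B ^\<^sub>m Suc l * U"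
    using B U by (simp only: pow_deriv.simps(2)[of _ _ "Suc l"] Suc)
      (simp add: mult_smult_assoc_mat[of _ n n _ n] mult_carrier_mat[of _ n n _ n])
  also have "\<dots> = of_nat (Suc (Suc l)) \<cdot>\<^sub>m (B ^\<^sub>m Suc l * U)"
    using B U by (intro eq_matI) (auto simp: algebra_simps simp del: index_mult_mat(1))
  finally show ?case .
qed (use B U in \<open>auto intro!: eq_matI\<close>)

lemma poly_mat_deriv_commuting:
  assumes B: "B \<in> carrier_mat n n" and U: "U \<in> carrier_mat n n" and comm: "B * U = U * B"
  shows "poly_mat_deriv f B U = poly_mat (formal_deriv f) B * U"
proof -
  have "poly_mat (formal_deriv f) B * U
      = mat_lincomb n (coeff (formal_deriv f)) (\<lambda>l. B ^\<^sub>m l * U) (degree f)"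
    using B U degree_formal_deriv[of f]
    by (simp add: poly_mat_eq_lincomb[of _ n _ "degree f"] mat_lincomb_mult)
  also have "\<dots> = poly_mat_deriv f B U"
  proof (rule eq_matI)
    fix i j assume "i < dim_row (poly_mat_deriv f B U)" "j < dim_col (poly_mat_deriv f B U)"
    then have ij: "i < n" "j < n"
      using B by (simp_all add: poly_mat_deriv_def)
    \<comment> \<open>The shifted sum runs up to \<open>degree f + 1\<close>; its additional coefficient vanishes.\<close>
    have "(\<Sum>l\<le>degree f. coeff (formal_deriv f) l * (B ^\<^sub>m l * U) $$ (i, j))
        = (\<Sum>l\<le>degree f. coeff f (Suc l) * pow_deriv B U (Suc l) $$ (i, j))"
      using B U ij unfolding pow_deriv_commuting[OF assms] coeff_formal_deriv
      by (intro sum.cong) (simp_all del: index_mult_mat(1) of_nat_Suc)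
    also have "\<dots> = (\<Sum>l\<le>Suc (degree f). coeff f l * pow_deriv B U l $$ (i, j))"
      using B ij by (simp del: pow_deriv.simps(2) sum.atMost_Suc add: sum.atMost_Suc_shift)
    also have "\<dots> = (\<Sum>l\<le>degree f. coeff f l * pow_deriv B U l $$ (i, j))"
      by (simp add: coeff_eq_0)
    finally show "mat_lincomb n (coeff (formal_deriv f)) (\<lambda>l. B ^\<^sub>m l * U) (degree f) $$ (i, j)
        = poly_mat_deriv f B U $$ (i, j)"
      using B ij by (simp add: mat_lincomb_def poly_mat_deriv_def)
  qed (use B in \<open>simp_all add: poly_mat_deriv_def\<close>)
  finally show ?thesis by simp
qed

lemma (in comm_ring_hom) map_mat_add:
  assumes "U \<in> carrier_mat n n" and "V \<in> carrier_mat n n"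
  shows "map_mat hom (U + V) = map_mat hom U + map_mat hom V"
  using assms by (intro eq_matI) (auto simp: hom_add)

lemma (in comm_ring_hom) map_pow_deriv:
  assumes "B \<in> carrier_mat n n" and "U \<in> carrier_mat n n"
  shows "map_mat hom (pow_deriv B U l) = pow_deriv (map_mat hom B) (map_mat hom U) l"
proof (induction l)
  case (Suc l)
  then show ?case
    using assms
    by (simp add: map_mat_add[of _ n] mat_hom_mult[of _ n n _ n] mat_hom_pow[of _ n] mult_carrier_mat[of _ n n _ n])
qed (use assms in \<open>auto intro!: eq_matI\<close>)

lemma (in comm_ring_hom) map_poly_mat_deriv:
  assumes "B \<in> carrier_mat n n" and "U \<in> carrier_mat n n" and "degree (map_poly hom f) = degree f"
  shows "map_mat hom (poly_mat_deriv f B U)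
    = poly_mat_deriv (map_poly hom f) (map_mat hom B) (map_mat hom U)"
proof -
  have "coeff (map_poly hom f) = (\<lambda>l. hom (coeff f l))"
    by (simp add: coeff_map_poly fun_eq_iff)
  moreover have "pow_deriv (map_mat hom B) (map_mat hom U) = (\<lambda>l. map_mat hom (pow_deriv B U l))"
    using map_pow_deriv[OF assms(1,2)] by auto
  ultimately show ?thesis
    using assms by (simp add: poly_mat_deriv_def map_mat_lincomb comp_def)
qed

section \<open>Bijectivity of the differential over a field\<close>

text \<open>The commutator identity puts a kernel element \<open>U\<close> into the centralizer of \<open>f(B)\<close>, which also
  contains \<open>B\<close> and is commutative. For \<open>U\<close> commuting with \<open>B\<close> the differential is multiplication
  by the invertible matrix \<open>f'(B)\<close>.\<close>

lemma poly_mat_deriv_inj: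
  fixes B U :: "'k::field mat"
  assumes B: "B \<in> carrier_mat n n" and U: "U \<in> carrier_mat n n"
    and sep: "separable_poly (char_poly (poly_mat f B))"
    and inv: "invertible_mat (poly_mat (formal_deriv f) B)"
    and zero: "poly_mat_deriv f B U = 0\<^sub>m n n"
  shows "U = 0\<^sub>m n n"
proof -
  let ?A = "poly_mat f B" and ?G = "poly_mat (formal_deriv f) B"
  have A: "?A \<in> carrier_mat n n" and G: "?G \<in> carrier_mat n n"
    using B by (simp_all add: poly_mat_carrier)
  have "?A * U - U * ?A = 0\<^sub>m n n"
    using poly_mat_deriv_commutator[OF B U, of f] B by (simp add: zero minus_r_inv_mat[of _ n n])
  have AU: "?A * U = U * ?A"
  proof (rule eq_matI)
    fix i j assume "i < dim_row (U * ?A)" "j < dim_col (U * ?A)"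
    then show "(?A * U) $$ (i, j) = (U * ?A) $$ (i, j)"
      using arg_cong[OF \<open>?A * U - U * ?A = 0\<^sub>m n n\<close>, of "\<lambda>M. M $$ (i, j)"] A U
      by (simp del: index_mult_mat(1))
  qed (use A U in auto)
  have AB: "?A * B = B * ?A"
    using poly_mat_commutes[OF B] by simp
  have "B * U = U * B"
    by (rule centralizer_commutative[OF A B U sep AB AU])
  then have GU: "?G * U = 0\<^sub>m n n"
    using poly_mat_deriv_commuting[OF B U] zero by simp
  obtain H where H: "H * ?G = 1\<^sub>m (dim_row H)" "?G * H = 1\<^sub>m n"
    using inv G by (auto simp: invertible_mat_def inverts_mat_def)
  have "dim_col H = n" "dim_row H = n"
    using arg_cong[OF H(1), of dim_col] arg_cong[OF H(2), of dim_col] G by simp_all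
  then have H': "H \<in> carrier_mat n n"
    by auto
  have "U = H * ?G * U"
    using U H(1) H' by simp
  also have "\<dots> = H * (?G * U)"
    using U G H' by (simp add: assoc_mult_mat[of _ n n _ n _ n])
  also have "\<dots> = 0\<^sub>m n n"
    using GU H' by simp
  finally show ?thesis .
qed

lemma finite_carrier_mat:
  assumes "finite (UNIV :: 'k set)"
  shows "finite (carrier_mat n m :: 'k mat set)"
proof -
  have "carrier_mat n m \<subseteq> mat n m ` (({0..<n} \<times> {0..<m}) \<rightarrow>\<^sub>E (UNIV :: 'k set))"
  proof
    fix U :: "'k mat"
    assume U: "U \<in> carrier_mat n m"
    show "U \<in> mat n m ` (({0..<n} \<times> {0..<m}) \<rightarrow>\<^sub>E UNIV)"
    proof (rule image_eqI)
      show "U = mat n m (restrict (\<lambda>ij. U $$ ij) ({0..<n} \<times> {0..<m}))"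
        using U by (intro eq_matI) auto
    qed simp
  qed
  moreover have "finite (({0..<n} \<times> {0..<m}) \<rightarrow>\<^sub>E (UNIV :: 'k set))"
    using assms by (intro finite_PiE) auto
  ultimately show ?thesis
    by (meson finite_imageI finite_subset)
qed

text \<open>The differential is an additive injection of a finite group into itself.\<close>

lemma poly_mat_deriv_surj:
  fixes B C :: "'k::field mat"
  assumes fin: "finite (UNIV :: 'k set)"
    and B: "B \<in> carrier_mat n n" and C: "C \<in> carrier_mat n n"
    and sep: "separable_poly (char_poly (poly_mat f B))"
    and inv: "invertible_mat (poly_mat (formal_deriv f) B)"
  obtains U where "U \<in> carrier_mat n n" and "poly_mat_deriv f B U = C"
proof -
  have "inj_on (poly_mat_deriv f B) (carrier_mat n n)"
  proof (rule inj_onI)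
    fix U V :: "'k mat"
    assume U: "U \<in> carrier_mat n n" and V: "V \<in> carrier_mat n n"
      and eq: "poly_mat_deriv f B U = poly_mat_deriv f B V"
    have "poly_mat_deriv f B (U - V) = 0\<^sub>m n n"
      unfolding poly_mat_deriv_minus[OF B U V] eq using poly_mat_deriv_carrier[OF B]
      by (intro minus_r_inv_mat)
    moreover have "U - V \<in> carrier_mat n n"
      using V by (rule minus_carrier_mat)
    ultimately have diff: "U - V = 0\<^sub>m n n"
      using poly_mat_deriv_inj[OF B _ sep inv] by blast
    show "U = V"
    proof (rule eq_matI)
      fix i j assume "i < dim_row V" "j < dim_col V"
      then show "U $$ (i, j) = V $$ (i, j)"
        using arg_cong[OF diff, of "\<lambda>M. M $$ (i, j)"] U V by simp
    qed (use U V in auto)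
  qed
  then have "poly_mat_deriv f B ` carrier_mat n n = carrier_mat n n"
    by (intro endo_inj_surj finite_carrier_mat[OF fin]) (auto simp: poly_mat_deriv_carrier[OF B])
  with C that show thesis
    by (metis imageE)
qed

section \<open>The square of the maximal ideal\<close>

lemma PIdl_class_ring: "PIdl\<^bsub>class_ring\<^esub> x = range (\<lambda>r. r * (x :: 'a::comm_ring_1))"
  by (auto simp: cgenideal_def)

lemma ideal_class_ring_range: "ideal (range (\<lambda>r. r * (x :: 'a::comm_ring_1))) class_ring"
  using cring.cgenideal_ideal[OF class_cring.cring_axioms, of x] by (simp add: PIdl_class_ring)

lemma ideal_class_ring_zero: "ideal {0 :: 'a::comm_ring_1} class_ring"
  using ideal_class_ring_range[of "0 :: 'a"] by simp

lemma ideal_class_ring_UNIV: "ideal (UNIV :: 'a::comm_ring_1 set) class_ring"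
  using ideal_class_ring_range[of "1 :: 'a"] by (simp add: surj_def)

lemma proper_ideal_le_maximal:
  fixes I :: "'a::{comm_ring_1, finite} set"
  assumes "ideal I class_ring" and "I \<noteq> UNIV"
  obtains M where "maximalideal M class_ring" and "I \<subseteq> M"
proof -
  let ?\<I> = "{J :: 'a set. ideal J class_ring \<and> J \<noteq> UNIV}"
  obtain M where M: "M \<in> ?\<I>" "I \<subseteq> M" "\<And>J. J \<in> ?\<I> \<Longrightarrow> M \<subseteq> J \<Longrightarrow> M = J"
    using finite_has_maximal2[of ?\<I> I] assms by auto
  have "maximalideal M class_ring"
    using M by (intro maximalidealI) auto
  with M(2) that show thesis
    by blast
qed

text \<open>If \<open>1 - e\<close> were not a unit, it would lie in some maximal ideal, and this is \<open>m\<close>; then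
  \<open>1 = (1 - e) + e \<in> m\<close>. A unit \<open>1 - e\<close> with \<open>(1 - e) e = 0\<close> forces \<open>e = 0\<close>.\<close>

lemma local_idempotent_zero:
  fixes m :: "'a::{comm_ring_1, finite} set"
  assumes "local_ring (class_ring :: 'a ring)" and m: "maximalideal m (class_ring :: 'a ring)"
    and e: "e \<in> m" "e * e = e"
  shows "e = 0"
proof -
  interpret m: maximalideal m "class_ring :: 'a ring"
    by (rule m)
  let ?I = "range (\<lambda>r. r * (1 - e))"
  have "?I = UNIV"
  proof (rule ccontr)
    assume "?I \<noteq> UNIV"
    then obtain M where M: "maximalideal M class_ring" "?I \<subseteq> M"
      using proper_ideal_le_maximal[OF ideal_class_ring_range] by blast
    with assms(1) m have "M = m"
      unfolding local_ring_def by blast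
    moreover have "1 - e \<in> ?I"
      by (rule range_eqI[of _ _ 1]) simp
    ultimately have "1 - e \<in> m"
      using M(2) by blast
    with e(1) have "1 \<in> m"
      using m.a_closed[of "1 - e" e] by simp
    then have "m = UNIV"
      using m.one_imp_carrier by simp
    with m.I_notcarr show False
      by simp
  qed
  then obtain r where "1 = r * (1 - e)"
    by blast
  then have "e = r * (1 - e) * e"
    by simp
  also have "\<dots> = 0"
    using e(2) by (simp add: left_diff_distrib mult.assoc)
  finally show ?thesis .
qed

lemma ring_length_ge_3:
  assumes "ideal I0 R" "ideal I1 R" "ideal I2 R" "ideal I3 R"
    and "I0 \<subset> I1" "I1 \<subset> I2" "I2 \<subset> I3"
  shows "3 \<le> ring_length R"
proof -
  let ?C = "{I0, I1, I2, I3}"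
  have "I0 \<noteq> I1" "I0 \<noteq> I2" "I0 \<noteq> I3" "I1 \<noteq> I2" "I1 \<noteq> I3" "I2 \<noteq> I3"
    using assms(5-7) by auto
  then have card: "card ?C = 4"
    by simp
  have "subset.chain {I. ideal I R} ?C"
    using assms unfolding pred_on.chain_def by auto
  then have "enat (card ?C - 1) \<le> ring_length R"
    unfolding ring_length_def by (intro SUP_upper) auto
  then show ?thesis
    by (simp add: card numeral_eq_enat)
qed

text \<open>If \<open>\<pi>\<^sup>2 \<noteq> 0\<close>, then \<open>0 \<subset> (\<pi>\<^sup>2) \<subset> (\<pi>) \<subset> O\<^sub>2\<close> is a strict chain. The inclusion in the middle is the one that
  needs locality: if \<open>\<pi> = r \<pi>\<^sup>2\<close>, then \<open>r \<pi>\<close> is an idempotent in the maximal ideal, hence zero, and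
  \<open>\<pi> = (r \<pi>) \<pi> = 0\<close>.\<close>

lemma uniformizer_square_zero:
  fixes m :: "'a::{comm_ring_1, finite} set"
  assumes "local_ring (class_ring :: 'a ring)" and len: "ring_length (class_ring :: 'a ring) = 2"
    and m: "maximalideal m (class_ring :: 'a ring)" and gen: "m = range (\<lambda>r. r * \<pi>)"
  shows "\<pi> * \<pi> = 0"
proof (rule ccontr)
  assume nz: "\<pi> * \<pi> \<noteq> 0"
  let ?s = "range (\<lambda>r. r * (\<pi> * \<pi>))"
  interpret m: maximalideal m "class_ring :: 'a ring"
    by (rule m)
  have pi_m: "\<pi> \<in> m"
    unfolding gen by (rule range_eqI[of _ _ 1]) simp
  have "\<pi> * \<pi> \<in> ?s" "0 \<in> ?s"
    by (rule range_eqI[of _ _ 1], simp, rule range_eqI[of _ _ 0], simp)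
  then have 1: "{0} \<subset> ?s"
    using nz by auto
  have "\<pi> \<notin> ?s"
  proof
    assume "\<pi> \<in> ?s"
    then obtain r where r: "\<pi> = r * (\<pi> * \<pi>)"
      by blast
    have "r * \<pi> * (r * \<pi>) = r * (r * (\<pi> * \<pi>))"
      by (simp add: algebra_simps)
    then have "r * \<pi> * (r * \<pi>) = r * \<pi>"
      using r by simp
    then have "r * \<pi> = 0"
      using local_idempotent_zero[OF assms(1) m] unfolding gen by blast
    with r nz show False
      by (metis mult.assoc mult_zero_left)
  qed
  moreover have "?s \<subseteq> m"
    unfolding gen by (auto simp flip: mult.assoc)
  ultimately have 2: "?s \<subset> m"
    using pi_m by blast
  have 3: "m \<subset> UNIV"
    using m.I_notcarr by auto
  have "3 \<le> ring_length (class_ring :: 'a ring)"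
    by (rule ring_length_ge_3[OF ideal_class_ring_zero ideal_class_ring_range m.is_ideal
          ideal_class_ring_UNIV 1 2 3])
  then show False
    by (simp add: len)
qed

section \<open>Lifting along a square-zero extension\<close>

text \<open>Lift an inverse of the residue to \<open>y\<close>. Then \<open>x y = 1 + r \<pi>\<close>, and \<open>(1 + r \<pi>) (1 - r \<pi>) = 1\<close> as \<open>\<pi>\<^sup>2 = 0\<close>.\<close>

lemma unit_if_residue_nonzero:
  fixes red :: "'a::comm_ring_1 \<Rightarrow> 'k::field"
  assumes red: "comm_ring_hom red" "surj red" and ker: "\<And>x. red x = 0 \<Longrightarrow> \<exists>r. x = r * \<pi>"
    and sq: "\<pi> * \<pi> = 0" and "red x \<noteq> 0"
  shows "\<exists>y. x * y = 1"
proof -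
  interpret comm_ring_hom red by (rule red)
  obtain y where y: "red y = inverse (red x)"
    using red(2) by (metis surjD)
  then have "red (x * y - 1) = 0"
    using assms(5) by (simp add: hom_minus hom_mult)
  then obtain r where r: "x * y - 1 = r * \<pi>"
    using ker by blast
  have "x * (y * (1 - r * \<pi>)) = (1 + r * \<pi>) * (1 - r * \<pi>)"
    using r by (simp add: algebra_simps)
  also have "\<dots> = 1 - r * r * (\<pi> * \<pi>)"
    by (simp add: algebra_simps)
  finally show ?thesis
    using sq by auto
qed

lemma invertible_mat_if_residue_invertible:
  fixes red :: "'a::comm_ring_1 \<Rightarrow> 'k::field"
  assumes red: "comm_ring_hom red" "surj red" and ker: "\<And>x. red x = 0 \<Longrightarrow> \<exists>r. x = r * \<pi>"
    and sq: "\<pi> * \<pi> = 0" and B: "B \<in> carrier_mat n n" and inv: "invertible_mat (map_mat red B)"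
  shows "invertible_mat B"
proof -
  interpret comm_ring_hom red by (rule red)
  let ?B = "map_mat red B"
  obtain H where H: "H * ?B = 1\<^sub>m (dim_row H)" "?B * H = 1\<^sub>m n"
    using inv B by (auto simp: invertible_mat_def inverts_mat_def)
  have "dim_col H = n" "dim_row H = n"
    using arg_cong[OF H(1), of dim_col] arg_cong[OF H(2), of dim_col] B by simp_all
  then have H': "H \<in> carrier_mat n n"
    by auto
  have "det ?B * det H = 1"
    using det_mult[of ?B n H] B H' by (simp add: H(2))
  then have "red (det B) \<noteq> 0"
    by (auto simp flip: hom_det)
  then obtain e where e: "det B * e = 1"
    using unit_if_residue_nonzero[OF red ker sq] by blast
  note adj = adj_mat[OF B]
  have "B * (e \<cdot>\<^sub>m adj_mat B) = 1\<^sub>m n" "(e \<cdot>\<^sub>m adj_mat B) * B = 1\<^sub>m n"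
    using B adj e
    by (auto simp: mult_smult_distrib[of _ n n _ n] mult_smult_assoc_mat[of _ n n _ n] mult.commute intro!: eq_matI)
  then show ?thesis
    using B adj(1) unfolding invertible_mat_def inverts_mat_def by auto
qed

text \<open>One Newton step suffices since \<open>\<pi>\<^sup>2 = 0\<close>. For the same reason the correction \<open>\<pi> U\<close> and the error \<open>\<pi> C\<close>
  depend only on the residues of \<open>U\<close> and \<open>C\<close>, so that the linear equation for \<open>U\<close> is one over \<open>k\<close>.\<close>

lemma poly_mat_root_lift:
  fixes red :: "'a::comm_ring_1 \<Rightarrow> 'k::field"
  assumes red: "comm_ring_hom red" "surj red" and ker: "\<And>x. red x = 0 \<Longrightarrow> \<exists>r. x = r * \<pi>"
    and sq: "\<pi> * \<pi> = 0" and red_pi: "red \<pi> = 0" and fin: "finite (UNIV :: 'k set)"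
    and A: "A \<in> carrier_mat n n" and Bt: "Bt \<in> carrier_mat n n"
    and sep: "separable_poly (char_poly (map_mat red A))"
    and F: "monic F"
    and FB: "poly_mat (map_poly red F) Bt = map_mat red A"
    and F'B: "invertible_mat (poly_mat (map_poly red (formal_deriv F)) Bt)"
  obtains B where "B \<in> carrier_mat n n" and "map_mat red B = Bt" and "poly_mat F B = A"
proof -
  interpret comm_ring_hom red by (rule red)
  have lift: "\<exists>V\<in>carrier_mat n n. map_mat red V = W" if "W \<in> carrier_mat n n" for W
    using that surj_f_inv_f[OF red(2)]
    by (intro bexI[of _ "map_mat (inv_into UNIV red) W"] eq_matI) auto
  have deg: "degree (map_poly red F) = degree F"
  proof (rule antisym)
    show "degree F \<le> degree (map_poly red F)"
      by (rule le_degree) (simp add: coeff_map_poly F)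
  qed (rule degree_map_poly_le)
  obtain B0 where B0: "B0 \<in> carrier_mat n n" "map_mat red B0 = Bt"
    using lift[OF Bt] by blast
  let ?E = "A - poly_mat F B0"
  have E: "?E \<in> carrier_mat n n"
    using B0 by (intro minus_carrier_mat poly_mat_carrier)
  have red_E: "red (?E $$ (i, j)) = 0" if ij: "i < n" "j < n" for i j
  proof -
    have "map_mat red (poly_mat F B0) = map_mat red A"
      using map_poly_mat[OF B0(1), of F] by (simp add: B0(2) FB)
    from arg_cong[OF this, of "\<lambda>M. M $$ (i, j)"] show ?thesis
      using A carrier_matD[OF poly_mat_carrier[OF B0(1), of F]] ij by (simp add: hom_minus)
  qed
  define C where "C = map_mat (\<lambda>x. SOME r. x = r * \<pi>) ?E"
  have C: "C \<in> carrier_mat n n"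
    using E by (simp add: C_def)
  have EC: "?E $$ (i, j) = C $$ (i, j) * \<pi>" if ij: "i < n" "j < n" for i j
  proof -
    have "?E $$ (i, j) = (SOME r. ?E $$ (i, j) = r * \<pi>) * \<pi>"
      by (rule someI_ex[OF ker[OF red_E[OF ij]]])
    then show ?thesis
      using E ij unfolding C_def by (metis carrier_matD index_map_mat(1))
  qed
  have "separable_poly (char_poly (poly_mat (map_poly red F) Bt))"
    using sep by (simp add: FB)
  moreover have "invertible_mat (poly_mat (formal_deriv (map_poly red F)) Bt)"
    using F'B by (simp add: map_formal_deriv)
  moreover have "map_mat red C \<in> carrier_mat n n"
    using C by simp
  ultimately obtain Ut where Ut: "Ut \<in> carrier_mat n n"
      "poly_mat_deriv (map_poly red F) Bt Ut = map_mat red C"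
    using poly_mat_deriv_surj[OF fin Bt] by metis
  obtain U where U: "U \<in> carrier_mat n n" "map_mat red U = Ut"
    using lift[OF Ut(1)] by blast
  \<comment> \<open>The residue of \<open>U\<close> solves \<open>D(U) = C\<close>, and the first order expansion absorbs the error \<open>\<pi> C\<close>.\<close>
  define B where "B = B0 + \<pi> \<cdot>\<^sub>m U"
  let ?D = "poly_mat_deriv F B0 U"
  have D: "?D \<in> carrier_mat n n"
    using B0 by (simp add: poly_mat_deriv_carrier)
  have B: "B \<in> carrier_mat n n"
    using U by (simp add: B_def)
  have "map_mat red B = Bt"
    unfolding B0(2)[symmetric] using B0(1) U(1) by (intro eq_matI) (auto simp: B_def hom_add hom_mult red_pi)
  moreover have "poly_mat F B = A"
  proof (rule eq_matI)
    fix i j assume "i < dim_row A" "j < dim_col A"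
    then have ij: "i < n" "j < n"
      using A by auto
    have "map_mat red ?D = map_mat red C"
      using map_poly_mat_deriv[OF B0(1) U(1) deg] by (simp add: B0(2) U(2) Ut(2))
    then have "red (C $$ (i, j) - ?D $$ (i, j)) = 0"
      using arg_cong[of _ _ "\<lambda>M. M $$ (i, j)"] C D ij by (simp add: hom_minus) (metis carrier_matD index_map_mat(1))
    then obtain r where "C $$ (i, j) - ?D $$ (i, j) = r * \<pi>"
      using ker by blast
    then have "(C $$ (i, j) - ?D $$ (i, j)) * \<pi> = 0"
      by (simp add: mult.assoc sq)
    then have "\<pi> * ?D $$ (i, j) = ?E $$ (i, j)"
      using EC[OF ij] by (simp add: algebra_simps)
    moreover have "poly_mat F B $$ (i, j) = poly_mat F B0 $$ (i, j) + \<pi> * ?D $$ (i, j)"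
      unfolding B_def poly_mat_expansion[OF B0(1) U(1) sq] using D ij by simp
    ultimately show "poly_mat F B $$ (i, j) = A $$ (i, j)"
      using A carrier_matD[OF poly_mat_carrier[OF B0(1), of F]] ij by simp
  qed (use A poly_mat_carrier[OF B, of F] in auto)
  ultimately show thesis
    using that B by blast
qed

theorem proposition4p3:
  fixes m :: "'a::{comm_ring_1, finite} set"
    and \<pi> :: 'a
    and red :: "'a \<Rightarrow> 'k::field"
    and p n d :: nat
    and A :: "'a mat"
    and F :: "'a poly"
    and Bt :: "'k mat"
  assumes "local_ring (class_ring :: 'a ring)"
    and "principal_ideal_ring (class_ring :: 'a ring)"
    and "ring_length (class_ring :: 'a ring) = 2"
    and "maximalideal m (class_ring :: 'a ring)"
    and "m = PIdl\<^bsub>class_ring :: 'a ring\<^esub> \<pi>"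
    and "residue_map m red"
    and "CHAR('k) = p" and "prime p" and "odd p"
    and "A \<in> carrier_mat n n"
    and "regular_semisimple red A"
    and "monic F" and "degree F = d"
    and "Bt \<in> carrier_mat n n"
    and "poly_mat (map_poly red F) Bt = map_mat red A"
    and "invertible_mat (poly_mat (map_poly red (formal_deriv F)) Bt)"
  shows "\<exists>B \<in> carrier_mat n n. map_mat red B = Bt \<and> poly_mat F B = A
    \<and> (invertible_mat Bt \<longrightarrow> invertible_mat B)"
proof -
  have m: "m = range (\<lambda>r. r * \<pi>)"
    using assms(5) by (simp only: PIdl_class_ring)
  have red: "comm_ring_hom red" "surj red" and ker_m: "{x. red x = 0} = m"
    using assms(6) by (simp_all add: residue_map_def)
  have ker: "\<exists>r. x = r * \<pi>" if "red x = 0" for x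
    using that ker_m m by auto
  have "\<pi> \<in> m"
    unfolding m by (rule range_eqI[of _ _ 1]) simp
  then have red_pi: "red \<pi> = 0"
    using ker_m by blast
  have sq: "\<pi> * \<pi> = 0"
    by (rule uniformizer_square_zero[OF assms(1,3,4) m])
  have fin: "finite (UNIV :: 'k set)"
    using red(2) by (metis finite finite_imageI)
  have sep: "separable_poly (char_poly (map_mat red A))"
    using assms(11) by (simp add: regular_semisimple_def)
  obtain B where B: "B \<in> carrier_mat n n" "map_mat red B = Bt" "poly_mat F B = A"
    using poly_mat_root_lift[OF red ker sq red_pi fin assms(10,14) sep assms(12,15,16)] by blast
  moreover have "invertible_mat Bt \<longrightarrow> invertible_mat B"
    using invertible_mat_if_residue_invertible[OF red ker sq B(1)] B(2) by blast
  ultimately show ?thesis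
    by blast
qed

end
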